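(* Assume that one evaluation of $f$ costs $T_f=O(1)$ queries. Then the query complexity of the problem $LSQR(f,n)$ (find an empty square of the largest size, for $f:\{0,\dots,n-1\}\times\{0,\dots,n-1\}\to\{0,1\}$) is $\Omega(n^2)$ in the classical (deterministic or randomized) case and $\Omega(n)$ in the quantum case.
   Context: Problem $LSQR(f,n)$ (Largest Empty Square): given $f:\{0,\dots,n-1\}^2\to\{0,1\}$, a triple $(x,y,d)$ with $0\le x,y\le n-1$, $1\le d\le n$, $d\le n-x$, $d\le n-y$ is an empty square of size $d$ if $f(i,j)=0$ for all $x\le i\le x+d-1$ and $y\le j\le y+d-1$. The goal is to output an empty square $(x,y,d)$ such that no empty square $(x',y',d')$ has $d'>d$ (if there is no empty square, output $(NULL,NULL,NULL)$). Query model: the input is the table of values of $f$, and a query reveals one value $f(i,j)$. In the quantum case a query is one application of the unitary $|i,j\rangle|z\rangle|w\rangle\mapsto|i,j\rangle|z+f(i,j) \bmod 2\rangle|w\rangle$, interleaved with arbitrary input-independent unitaries and followed by a final measurement. The (randomized or quantum) query complexity of the problem is the smallest worst-case number of queries of an algorithm that, on every input, outputs a correct answer with probability at least $2/3$. *)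

theory Defs
  imports
    "HOL-Probability.Probability"
    "HOL-Library.Landau_Symbols"
    "HOL-Library.Extended_Real"
    "Jordan_Normal_Form.Schur_Decomposition"
begin

section \<open>The problem of the largest empty square\<close>

definition inputs :: "nat \<Rightarrow> (nat \<times> nat \<Rightarrow> nat) set" where
  "inputs n = ({0..<n} \<times> {0..<n}) \<rightarrow>\<^sub>E {0, 1}"

definition empty_square :: "nat \<Rightarrow> (nat \<times> nat \<Rightarrow> nat) \<Rightarrow> nat \<Rightarrow> nat \<Rightarrow> nat \<Rightarrow> bool" where
  "empty_square n f x y d \<longleftrightarrow>
     x < n \<and> y < n \<and> 1 \<le> d \<and> d \<le> n \<and> d \<le> n - x \<and> d \<le> n - y \<and>
     (\<forall>i\<in>{x..x + d - 1}. \<forall>j\<in>{y..y + d - 1}. f (i, j) = 0)"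

text \<open>The answer \<open>None\<close> stands for the triple (NULL, NULL, NULL).\<close>

type_synonym answer = "(nat \<times> nat \<times> nat) option"

definition LSQR :: "nat \<Rightarrow> (nat \<times> nat \<Rightarrow> nat) \<Rightarrow> answer \<Rightarrow> bool" where
  "LSQR n f a \<longleftrightarrow>
     (case a of
        None \<Rightarrow> \<not> (\<exists>x y d. empty_square n f x y d)
      | Some (x, y, d) \<Rightarrow> empty_square n f x y d \<and>
          \<not> (\<exists>x' y' d'. empty_square n f x' y' d' \<and> d' > d))"

section \<open>Classical query complexity\<close>

text \<open>
  A computational problem on \<^term>\<open>inputs n\<close> is a relation \<open>P\<close>, where \<open>P f a\<close> says that \<open>a\<close> is a
  correct answer on input \<open>f\<close>. A deterministic algorithm is a decision tree: the first subtree of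
  a query node is entered if the revealed value is 0, the second one otherwise.
\<close>

datatype 'a dtree = Answer 'a | Query "nat \<times> nat" "'a dtree" "'a dtree"

primrec run :: "'a dtree \<Rightarrow> (nat \<times> nat \<Rightarrow> nat) \<Rightarrow> 'a" where
  "run (Answer a) f = a"
| "run (Query p t u) f = (if f p = 0 then run t f else run u f)"

primrec queries :: "'a dtree \<Rightarrow> (nat \<times> nat \<Rightarrow> nat) \<Rightarrow> nat" where
  "queries (Answer a) f = 0"
| "queries (Query p t u) f = Suc (if f p = 0 then queries t f else queries u f)"

primrec queries_within :: "nat \<Rightarrow> 'a dtree \<Rightarrow> bool" where
  "queries_within n (Answer a) \<longleftrightarrow> True"
| "queries_within n (Query p t u) \<longleftrightarrow>
     p \<in> {0..<n} \<times> {0..<n} \<and> queries_within n t \<and> queries_within n u"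

text \<open>
  The complexities below are infima in \<^typ>\<open>enat\<close>, i.e. minima of sets of natural numbers, with
  the value \<open>\<infinity>\<close> for a problem that no algorithm solves.
\<close>

definition det_query_complexity :: "nat \<Rightarrow> ((nat \<times> nat \<Rightarrow> nat) \<Rightarrow> 'a \<Rightarrow> bool) \<Rightarrow> enat" where
  "det_query_complexity n P =
     (INF q \<in> {q. \<exists>t. queries_within n t \<and>
                       (\<forall>f\<in>inputs n. P f (run t f) \<and> queries t f \<le> q)}. enat q)"

text \<open>
  A randomized algorithm is a probability distribution on decision trees. Its worst-case number of
  queries is the maximum over the inputs and over the trees of positive probability.
\<close>

definition rand_query_complexity :: "nat \<Rightarrow> ((nat \<times> nat \<Rightarrow> nat) \<Rightarrow> 'a \<Rightarrow> bool) \<Rightarrow> enat" where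
  "rand_query_complexity n P =
     (INF q \<in> {q. \<exists>A :: 'a dtree pmf.
                 (\<forall>t\<in>set_pmf A. queries_within n t \<and> (\<forall>f\<in>inputs n. queries t f \<le> q)) \<and>
                 (\<forall>f\<in>inputs n. measure_pmf.prob A {t. P f (run t f)} \<ge> 2 / 3)}. enat q)"

section \<open>Quantum query complexity\<close>

text \<open>
  The basis states \<open>|i,j\<rangle>|z\<rangle>|w\<rangle>\<close> with \<open>i, j < n\<close>, \<open>z < 2\<close> and \<open>w < m\<close> are numbered by
  \<open>qindex n m i j z w\<close>, a bijection onto \<open>{0..<qdim n m}\<close>; \<open>m\<close> is the dimension of the work space.
\<close>

definition qdim :: "nat \<Rightarrow> nat \<Rightarrow> nat" where
  "qdim n m = n * n * 2 * m"

definition qindex :: "nat \<Rightarrow> nat \<Rightarrow> nat \<Rightarrow> nat \<Rightarrow> nat \<Rightarrow> nat \<Rightarrow> nat" where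
  "qindex n m i j z w = ((i * n + j) * 2 + z) * m + w"

definition query_mat :: "nat \<Rightarrow> nat \<Rightarrow> (nat \<times> nat \<Rightarrow> nat) \<Rightarrow> complex mat" where
  "query_mat n m f = mat (qdim n m) (qdim n m) (\<lambda>(r, c).
     if \<exists>i<n. \<exists>j<n. \<exists>z<2. \<exists>w<m.
          c = qindex n m i j z w \<and> r = qindex n m i j ((z + f (i, j)) mod 2) w
     then 1 else 0)"

definition unitary :: "nat \<Rightarrow> complex mat \<Rightarrow> bool" where
  "unitary D U \<longleftrightarrow> U \<in> carrier_mat D D \<and> mat_adjoint U * U = 1\<^sub>m D \<and> U * mat_adjoint U = 1\<^sub>m D"

text \<open>
  A general quantum measurement: operators \<open>M a\<close>, one for each of finitely many outcomes \<open>a \<in> S\<close>,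
  such that the sum of all \<open>(M a)\<^sup>\<dagger> (M a)\<close> is the identity. On a unit vector \<open>v\<close> the outcome \<open>a\<close>
  has probability \<open>\<parallel>M a v\<parallel>\<^sup>2\<close>. The sum of matrices is written entrywise.
\<close>

definition measurement :: "nat \<Rightarrow> 'a set \<Rightarrow> ('a \<Rightarrow> complex mat) \<Rightarrow> bool" where
  "measurement D S M \<longleftrightarrow>
     finite S \<and> (\<forall>a\<in>S. M a \<in> carrier_mat D D) \<and>
     (\<forall>r<D. \<forall>c<D. (\<Sum>a\<in>S. (mat_adjoint (M a) * M a) $$ (r, c)) = 1\<^sub>m D $$ (r, c))"

definition norm_sq :: "complex Matrix.vec \<Rightarrow> real" where
  "norm_sq v = (\<Sum>k<dim_vec v. (cmod (vec_index v k))\<^sup>2)"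

text \<open>
  \<open>qstate n m U f k\<close> is the state after \<open>k\<close> queries, from the basis state \<open>|0,0\<rangle>|0\<rangle>|0\<rangle>\<close>
  and with \<open>U 0\<close> applied before the first query and \<open>U k\<close> after the \<open>k\<close>-th one.
\<close>

primrec qstate ::
  "nat \<Rightarrow> nat \<Rightarrow> (nat \<Rightarrow> complex mat) \<Rightarrow> (nat \<times> nat \<Rightarrow> nat) \<Rightarrow> nat \<Rightarrow> complex Matrix.vec" where
  "qstate n m U f 0 = U 0 *\<^sub>v unit_vec (qdim n m) (qindex n m 0 0 0 0)"
| "qstate n m U f (Suc k) = U (Suc k) *\<^sub>v (query_mat n m f *\<^sub>v qstate n m U f k)"

definition quantum_query_complexity :: "nat \<Rightarrow> ((nat \<times> nat \<Rightarrow> nat) \<Rightarrow> 'a \<Rightarrow> bool) \<Rightarrow> enat" where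
  "quantum_query_complexity n P =
     (INF q \<in> {q. \<exists>m U S M. 1 \<le> m \<and> (\<forall>k\<le>q. unitary (qdim n m) (U k)) \<and>
                 measurement (qdim n m) (S :: 'a set) M \<and>
                 (\<forall>f\<in>inputs n.
                    (\<Sum>a | a \<in> S \<and> P f a. norm_sq (M a *\<^sub>v qstate n m U f q)) \<ge> 2 / 3)}. enat q)"

section \<open>Asymptotic lower bounds\<close>

text \<open>\<open>F \<in> \<Omega>(g)\<close> as in \<^const>\<open>bigomega\<close>, for functions with values in \<^typ>\<open>enat\<close>.\<close>

definition enat_bigomega :: "(nat \<Rightarrow> enat) \<Rightarrow> (nat \<Rightarrow> real) \<Rightarrow> bool" where
  "enat_bigomega F g \<longleftrightarrow>
     (\<exists>c>0. \<forall>\<^sub>F n in sequentially. ereal (c * \<bar>g n\<bar>) \<le> ereal_of_enat (F n))"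

end

theory Submission
  imports Defs
begin

text \<open>
  The table of ones has no empty square, and replacing one value by 0 makes that cell the unique
  empty square, so an algorithm has to detect a single marked cell among \<open>n\<^sup>2\<close>. Classically it must
  query each cell with probability at least \<open>1/3\<close> on the table of ones. In the quantum case this is
  the hybrid argument of Bennett, Bernstein, Brassard and Vazirani: changing cell \<open>p\<close> moves the
  final state by at most \<open>2 \<Sum>\<^sub>k sqrt (W\<^sub>k p)\<close>, where \<open>W\<^sub>k p\<close> is the squared norm of the part of the
  state before query \<open>k + 1\<close> on the table of ones that sits on cell \<open>p\<close>. Since \<open>\<Sum>\<^sub>p W\<^sub>k p = 1\<close>,
  the Cauchy-Schwarz inequality forces \<open>q\<^sup>2 \<ge> n\<^sup>2 / 100\<close>.
\<close>

section \<open>Randomized search\<close>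

fun queried :: "'a dtree \<Rightarrow> (nat \<times> nat \<Rightarrow> nat) \<Rightarrow> (nat \<times> nat) set" where
  "queried (Answer a) f = {}"
| "queried (Query p t u) f = insert p (if f p = 0 then queried t f else queried u f)"

lemma finite_queried [simp]: "finite (queried t f)"
  by (induction t) auto

text \<open>A cell met twice on a path counts once on the left and twice on the right.\<close>

lemma card_queried_le: "card (queried t f) \<le> queries t f"
proof (induction t)
  case (Query p t u)
  have "card (queried (Query p t u) f) \<le> Suc (card (if f p = 0 then queried t f else queried u f))"
    using card_insert_le_m1 by (simp add: card_insert_if)
  with Query show ?case by auto
qed simp

lemma run_cong: "(\<And>p. p \<in> queried t f \<Longrightarrow> g p = f p) \<Longrightarrow> run t g = run t f"
  by (induction t) auto

text \<open>A tree that is correct on both \<open>g\<close> and \<open>h p\<close> must query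
  \<open>p\<close> when run on \<open>g\<close>: otherwise both runs follow the same path to the
  same answer, which \<open>disjoint\<close> forbids. Two events of probability at least 2/3 meet
  with probability at least 1/3, and summing over \<open>p\<close> bounds the expected number of
  cells of \<open>X\<close> queried on \<open>g\<close>.\<close>

lemma rand_queries_ge:
  fixes P :: "(nat \<times> nat \<Rightarrow> nat) \<Rightarrow> 'a \<Rightarrow> bool" and A :: "'a dtree pmf"
  assumes queries: "\<And>t. t \<in> set_pmf A \<Longrightarrow> queries t g \<le> q"
    and correct: "2 / 3 \<le> measure_pmf.prob A {t. P g (run t g)}"
    and correct': "\<And>p. p \<in> X \<Longrightarrow> 2 / 3 \<le> measure_pmf.prob A {t. P (h p) (run t (h p))}"
    and agree: "\<And>p p'. p \<in> X \<Longrightarrow> p' \<noteq> p \<Longrightarrow> h p p' = g p'"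
    and disjoint: "\<And>p a. p \<in> X \<Longrightarrow> P g a \<Longrightarrow> \<not> P (h p) a"
    and "finite X"
  shows "card X / 3 \<le> real q"
proof -
  have *: "1 / 3 \<le> measure_pmf.prob A {t. p \<in> queried t g}" if p: "p \<in> X" for p
  proof -
    let ?B = "{t. P g (run t g)}" and ?C = "{t. P (h p) (run t (h p))}"
    have "run t (h p) = run t g" if "p \<notin> queried t g" for t
      using that agree[OF p] by (intro run_cong) metis
    hence sub: "?B \<inter> ?C \<subseteq> {t. p \<in> queried t g}"
      using disjoint[OF p] by force
    \<comment> \<open>Inclusion-exclusion: 4/3 is at most 1 plus the probability of the
      intersection.\<close>
    have "measure_pmf.prob A ?B + measure_pmf.prob A ?C
        = measure_pmf.prob A (?B \<union> ?C) + measure_pmf.prob A (?B \<inter> ?C)"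
      by (subst measure_Un3) (auto simp: fmeasurable_def less_top[symmetric])
    also have "\<dots> \<le> 1 + measure_pmf.prob A {t. p \<in> queried t g}"
      by (intro add_mono measure_pmf.prob_le_1 measure_pmf.finite_measure_mono sub) auto
    finally show ?thesis using correct correct'[OF p] by simp
  qed
  have "card X / 3 = (\<Sum>p\<in>X. 1 / 3)" by simp
  also have "\<dots> \<le> (\<Sum>p\<in>X. measure_pmf.prob A {t. p \<in> queried t g})"
    by (intro sum_mono *)
  also have "\<dots> = (\<Sum>p\<in>X. measure_pmf.expectation A (indicator {t. p \<in> queried t g}))"
    by simp
  \<comment> \<open>By linearity of expectation the integrand becomes the number of cells of
    \<open>X\<close> that one tree queries, at most \<open>q\<close> for every tree in the
    support.\<close>
  also have "\<dots> = measure_pmf.expectation A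
      (\<lambda>t. \<Sum>p\<in>X. indicator {t. p \<in> queried t g} t)"
    by (subst Bochner_Integration.integral_sum) (auto simp: less_top[symmetric])
  also have "\<dots> \<le> measure_pmf.expectation A (\<lambda>_. real q)"
  proof (intro integral_mono_AE AE_pmfI)
    fix t assume t: "t \<in> set_pmf A"
    have "(\<Sum>p\<in>X. indicator {t. p \<in> queried t g} t :: real) = real (card (X \<inter> queried t g))"
      by (simp add: indicator_def sum.If_cases \<open>finite X\<close> Int_def)
    also have "\<dots> \<le> card (queried t g)"
      by (intro of_nat_mono card_mono) auto
    also have "\<dots> \<le> q"
      using card_queried_le[of t g] queries[OF t] by simp
    finally show "(\<Sum>p\<in>X. indicator {t. p \<in> queried t g} t) \<le> real q" .
  qed (auto simp: less_top[symmetric])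
  finally show ?thesis by simp
qed

text \<open>A decision tree is a point distribution with success probability 1, so the randomized
  infimum ranges over a larger set. The deterministic bound thus reduces to the randomized
  one.\<close>

lemma rand_le_det_query_complexity:
  fixes P :: "(nat \<times> nat \<Rightarrow> nat) \<Rightarrow> 'a \<Rightarrow> bool"
  shows "rand_query_complexity n P \<le> det_query_complexity n P"
  unfolding rand_query_complexity_def det_query_complexity_def
proof (rule INF_superset_mono)
  show "{q. \<exists>t. queries_within n t \<and> (\<forall>f\<in>inputs n. P f (run t f) \<and> queries t f \<le> q)}
    \<subseteq> {q. \<exists>A :: 'a dtree pmf.
                 (\<forall>t\<in>set_pmf A. queries_within n t \<and> (\<forall>f\<in>inputs n. queries t f \<le> q)) \<and>
                 (\<forall>f\<in>inputs n. measure_pmf.prob A {t. P f (run t f)} \<ge> 2 / 3)}"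
  proof safe
    fix q t assume "queries_within n t" "\<forall>f\<in>inputs n. P f (run t f) \<and> queries t f \<le> q"
    thus "\<exists>A :: 'a dtree pmf.
                 (\<forall>t\<in>set_pmf A. queries_within n t \<and> (\<forall>f\<in>inputs n. queries t f \<le> q)) \<and>
                 (\<forall>f\<in>inputs n. measure_pmf.prob A {t. P f (run t f)} \<ge> 2 / 3)"
      by (intro exI[of _ "return_pmf t"]) (auto simp: measure_return_pmf)
  qed
qed simp

section \<open>Query weights and the hybrid argument\<close>

lemma qindex_less:
  assumes "i < n" "j < n" "z < 2" "w < m"
  shows "qindex n m i j z w < qdim n m"
proof -
  \<comment> \<open>\<open>qindex\<close> is a mixed-radix numeral; this bound appends one digit and
    is applied three times.\<close>
  have *: "a * b' + b < a' * b'" if "a < a'" "b < b'" for a b a' b' :: nat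
  proof -
    have "a * b' + b < Suc a * b'" using that by simp
    also have "\<dots> \<le> a' * b'" using that by (intro mult_le_mono1) simp
    finally show ?thesis .
  qed
  show ?thesis unfolding qindex_def qdim_def by (intro * assms)
qed

lemma qindex_inject:
  assumes "j < n" "z < 2" "w < m" "j' < n" "z' < 2" "w' < m"
  shows "qindex n m i j z w = qindex n m i' j' z' w' \<longleftrightarrow> i = i' \<and> j = j' \<and> z = z' \<and> w = w'"
proof -
  have *: "a * c + b = a' * c + b' \<longleftrightarrow> a = a' \<and> b = b'" if "b < c" "b' < c" for a b a' b' c :: nat
  proof
    assume eq: "a * c + b = a' * c + b'"
    have "(a * c + b) div c = a" "(a' * c + b') div c = a'" using that by auto
    with eq show "a = a' \<and> b = b'" by auto
  qed simp
  show ?thesis unfolding qindex_def *[OF assms(3,6)] *[OF assms(2,5)] *[OF assms(1,4)] by blast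
qed

text \<open>Surjectivity follows by counting. The pairs are nested so that a sum over all basis
  states splits into a sum over cells.\<close>

lemma bij_betw_qindex:
  "bij_betw (\<lambda>((i, j), z, w). qindex n m i j z w)
     (({..<n} \<times> {..<n}) \<times> {..<2} \<times> {..<m}) {..<qdim n m}" (is "bij_betw ?h ?X ?Y")
proof -
  have inj: "inj_on ?h ?X"
    by (auto simp: inj_on_def qindex_inject)
  have "card ?X = card ?Y"
    by (simp add: card_cartesian_product qdim_def)
  moreover have "?h ` ?X \<subseteq> ?Y"
    by (auto simp: qindex_less)
  ultimately have "?h ` ?X = ?Y"
    by (intro card_subset_eq) (simp_all add: card_image inj)
  with inj show ?thesis by (simp add: bij_betw_def)
qed

text \<open>The squared norm of the projection of \<open>v\<close> onto the states whose query
  register holds \<open>p\<close>; for a unit vector, the probability of observing \<open>p\<close>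
  there.\<close>

definition cell_weight :: "nat \<Rightarrow> nat \<Rightarrow> complex Matrix.vec \<Rightarrow> nat \<times> nat \<Rightarrow> real" where
  "cell_weight n m v p =
     (\<Sum>(z, w)\<in>{..<2} \<times> {..<m}. (cmod (vec_index v (qindex n m (fst p) (snd p) z w)))\<^sup>2)"

lemma norm_sq_eq_sum_cell_weight:
  assumes "v \<in> carrier_vec (qdim n m)"
  shows "norm_sq v = (\<Sum>p\<in>{..<n} \<times> {..<n}. cell_weight n m v p)"
  using assms unfolding norm_sq_def cell_weight_def
  by (simp add: sum.reindex_bij_betw[OF bij_betw_qindex, symmetric] sum.cartesian_product
      case_prod_unfold)

lemma cell_weight_nonneg: "0 \<le> cell_weight n m v p"
  unfolding cell_weight_def by (intro sum_nonneg) auto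

lemma cell_weight_diff_le:
  assumes "p \<in> {..<n} \<times> {..<n}" "x \<in> carrier_vec (qdim n m)" "y \<in> carrier_vec (qdim n m)"
  shows "cell_weight n m (x - y) p \<le> 2 * cell_weight n m x p + 2 * cell_weight n m y p"
proof -
  have *: "(cmod (a - b))\<^sup>2 \<le> 2 * (cmod a)\<^sup>2 + 2 * (cmod b)\<^sup>2" for a b
  proof -
    have "(cmod (a - b))\<^sup>2 \<le> (cmod a + cmod b)\<^sup>2"
      by (intro power_mono norm_triangle_ineq4) auto
    also have "\<dots> \<le> 2 * (cmod a)\<^sup>2 + 2 * (cmod b)\<^sup>2"
      using sum_squares_bound[of "cmod a" "cmod b"] by (simp add: power2_sum)
    finally show ?thesis .
  qed
  show ?thesis
    unfolding cell_weight_def sum_distrib_left sum.distrib[symmetric]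
    using assms by (intro sum_mono) (auto simp: qindex_less *)
qed

section \<open>The action of a query on weights and norms\<close>

lemma query_mat_carrier [simp]: "query_mat n m f \<in> carrier_mat (qdim n m) (qdim n m)"
  by (simp add: query_mat_def)

lemma query_mat_mult_index:
  assumes "v \<in> carrier_vec (qdim n m)" "i < n" "j < n" "z < 2" "w < m"
  shows "vec_index (query_mat n m f *\<^sub>v v) (qindex n m i j z w)
       = vec_index v (qindex n m i j ((z + f (i, j)) mod 2) w)"
proof -
  let ?r = "qindex n m i j z w" and ?s = "qindex n m i j ((z + f (i, j)) mod 2) w"
  have r: "?r < qdim n m" and s: "?s < qdim n m"
    using assms by (auto intro!: qindex_less)
  \<comment> \<open>The query is an involution on basis states, so the column holding the only 1 of
    a row is given by the same formula as the image of a basis state.\<close>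
  have flip: "z = (z' + k) mod 2 \<longleftrightarrow> z' = (z + k) mod 2" if "z' < 2" for z' k :: nat
  proof -
    have "z = 0 \<or> z = 1" "z' = 0 \<or> z' = 1" using that assms(4) by auto
    thus ?thesis by (elim disjE) (auto simp: mod2_eq_if)
  qed
  have entry: "query_mat n m f $$ (?r, c) = (if c = ?s then 1 else 0)" if "c < qdim n m" for c
  proof -
    have "(\<exists>i'<n. \<exists>j'<n. \<exists>z'<2. \<exists>w'<m. c = qindex n m i' j' z' w' \<and>
            ?r = qindex n m i' j' ((z' + f (i', j')) mod 2) w') \<longleftrightarrow> c = ?s"
    proof
      assume c: "c = ?s"
      let ?z = "(z + f (i, j)) mod 2"
      have "?z < 2" "z = (?z + f (i, j)) mod 2"
        using flip[of ?z "f (i, j)"] by auto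
      with c assms show "\<exists>i'<n. \<exists>j'<n. \<exists>z'<2. \<exists>w'<m. c = qindex n m i' j' z' w' \<and>
          ?r = qindex n m i' j' ((z' + f (i', j')) mod 2) w'"
        by metis
    qed (use assms in \<open>auto simp: qindex_inject flip\<close>)
    thus ?thesis using that r by (simp add: query_mat_def)
  qed
  have "vec_index (query_mat n m f *\<^sub>v v) ?r
      = (\<Sum>c<qdim n m. (if c = ?s then 1 else 0) * vec_index v c)"
    using assms(1) r
    by (simp add: scalar_prod_def atLeast0LessThan entry carrier_matD[OF query_mat_carrier])
  also have "\<dots> = vec_index v ?s"
    using s by (simp add: if_distrib[of "\<lambda>x. x * _"] sum.delta cong: if_cong)
  finally show ?thesis .
qed

text \<open>Within a cell a query either fixes the basis states or swaps \<open>z = 0\<close> with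
  \<open>z = 1\<close>, according to the parity of the value of \<open>f\<close> there; the sum of
  squares is invariant under both.\<close>

lemma cell_weight_query:
  assumes "v \<in> carrier_vec (qdim n m)" "p \<in> {..<n} \<times> {..<n}"
  shows "cell_weight n m (query_mat n m f *\<^sub>v v) p = cell_weight n m v p"
proof -
  obtain i j where p: "p = (i, j)" "i < n" "j < n" using assms(2) by auto
  have 2: "{..<2} = {0, 1::nat}" by auto
  have "cell_weight n m (query_mat n m f *\<^sub>v v) p
      = (\<Sum>z<2. \<Sum>w<m. (cmod (vec_index v (qindex n m i j ((z + f (i, j)) mod 2) w)))\<^sup>2)"
    using assms p by (simp add: cell_weight_def query_mat_mult_index sum.cartesian_product[symmetric])
  also have "\<dots> = cell_weight n m v p"
  proof (cases "even (f (i, j))")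
    case True
    thus ?thesis by (simp add: p cell_weight_def 2 sum.cartesian_product[symmetric] mod2_eq_if)
  next
    case False
    thus ?thesis by (simp add: p cell_weight_def 2 sum.cartesian_product[symmetric] mod2_eq_if)
  qed
  finally show ?thesis .
qed

lemma norm_sq_query:
  assumes "v \<in> carrier_vec (qdim n m)"
  shows "norm_sq (query_mat n m f *\<^sub>v v) = norm_sq v"
  using assms
  by (simp add: norm_sq_eq_sum_cell_weight[where n = n and m = m] cell_weight_query
      mult_mat_vec_carrier[OF query_mat_carrier])

text \<open>The two query operators differ only on cell \<open>p\<close>, so the difference is
  supported there. It is a difference of two vectors of equal weight on \<open>p\<close>, and
  \<open>cell_weight_diff_le\<close> gives 2 + 2 = 4.\<close>

lemma norm_sq_query_diff_le:
  assumes v: "v \<in> carrier_vec (qdim n m)" and p: "p \<in> {..<n} \<times> {..<n}"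
    and agree: "\<And>p'. p' \<noteq> p \<Longrightarrow> f p' = g p'"
  shows "norm_sq (query_mat n m g *\<^sub>v v - query_mat n m f *\<^sub>v v) \<le> 4 * cell_weight n m v p"
proof -
  let ?d = "query_mat n m g *\<^sub>v v - query_mat n m f *\<^sub>v v"
  have c: "query_mat n m f *\<^sub>v v \<in> carrier_vec (qdim n m)" for f
    using mult_mat_vec_carrier[OF query_mat_carrier v] .
  have 0: "cell_weight n m ?d p' = 0" if "p' \<in> {..<n} \<times> {..<n}" "p' \<noteq> p" for p'
    unfolding cell_weight_def
  proof (intro sum.neutral ballI)
    fix x assume "x \<in> {..<2::nat} \<times> {..<m}"
    thus "(case x of (z, w) \<Rightarrow>
        (cmod (vec_index ?d (qindex n m (fst p') (snd p') z w)))\<^sup>2) = 0"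
      using that agree[OF that(2)] c v by (cases x) (auto simp: qindex_less query_mat_mult_index
         carrier_matD[OF query_mat_carrier] simp del: index_mult_mat_vec)
  qed
  have "norm_sq ?d = (\<Sum>p'\<in>{..<n} \<times> {..<n}. cell_weight n m ?d p')"
    by (intro norm_sq_eq_sum_cell_weight minus_carrier_vec c)
  also have "\<dots> = (\<Sum>p'\<in>{p}. cell_weight n m ?d p')"
    by (intro sum.mono_neutral_right) (use p 0 in auto)
  also have "\<dots> \<le> 4 * cell_weight n m v p"
    using cell_weight_diff_le[OF p c c, of g f] by (simp add: cell_weight_query v p)
  finally show ?thesis .
qed

section \<open>Norm preservation by measurements and unitaries\<close>

lemma norm_sq_mult_mat_vec:
  assumes "A \<in> carrier_mat D D" "v \<in> carrier_vec D"
  shows "complex_of_real (norm_sq (A *\<^sub>v v)) =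
    (\<Sum>r<D. \<Sum>c<D. cnj (vec_index v r) * (mat_adjoint A * A) $$ (r, c) * vec_index v c)"
proof -
  have entry: "(mat_adjoint A * A) $$ (r, c) = (\<Sum>k<D. cnj (A $$ (k, r)) * A $$ (k, c))"
    if "r < D" "c < D" for r c
    using that assms
    by (simp add: mat_adjoint_def mat_of_rows_def scalar_prod_def atLeast0LessThan)
  have "complex_of_real (norm_sq (A *\<^sub>v v))
      = (\<Sum>k<D. cnj (\<Sum>r<D. A $$ (k, r) * vec_index v r) * (\<Sum>c<D. A $$ (k, c) * vec_index v c))"
    using assms
    by (simp add: norm_sq_def scalar_prod_def atLeast0LessThan complex_norm_square mult.commute
       del: of_real_power)
  also have "\<dots> = (\<Sum>k<D. \<Sum>r<D. \<Sum>c<D.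
      cnj (vec_index v r) * (cnj (A $$ (k, r)) * A $$ (k, c)) * vec_index v c)"
    unfolding cnj_sum sum_product by (simp add: mult_ac)
  also have "\<dots> = (\<Sum>r<D. \<Sum>c<D. \<Sum>k<D.
      cnj (vec_index v r) * (cnj (A $$ (k, r)) * A $$ (k, c)) * vec_index v c)"
    by (subst sum.swap) (intro sum.cong refl sum.swap)
  also have "\<dots> = (\<Sum>r<D. \<Sum>c<D.
      cnj (vec_index v r) * (mat_adjoint A * A) $$ (r, c) * vec_index v c)"
    by (intro sum.cong refl) (simp add: entry sum_distrib_left sum_distrib_right del: index_mult_mat)
  finally show ?thesis .
qed

text \<open>Each summand is the quadratic form of \<open>mat_adjoint (M a) * M a\<close> at
  \<open>v\<close>; these forms add up to that of the identity. The computation is in the complex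
  numbers and returns to the reals by injectivity of \<open>complex_of_real\<close>.\<close>

lemma sum_norm_sq_of_adjoint_sum:
  assumes M: "\<And>a. a \<in> S \<Longrightarrow> M a \<in> carrier_mat D D"
    and one: "\<And>r c. r < D \<Longrightarrow> c < D \<Longrightarrow>
      (\<Sum>a\<in>S. (mat_adjoint (M a) * M a) $$ (r, c)) = 1\<^sub>m D $$ (r, c)"
    and v: "v \<in> carrier_vec D"
  shows "(\<Sum>a\<in>S. norm_sq (M a *\<^sub>v v)) = norm_sq v"
proof -
  have "complex_of_real (\<Sum>a\<in>S. norm_sq (M a *\<^sub>v v)) = (\<Sum>a\<in>S. \<Sum>r<D. \<Sum>c<D.
      cnj (vec_index v r) * (mat_adjoint (M a) * M a) $$ (r, c) * vec_index v c)"
    by (simp add: norm_sq_mult_mat_vec[OF M v] del: index_mult_mat)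
  also have "\<dots> = (\<Sum>r<D. \<Sum>c<D. \<Sum>a\<in>S.
      cnj (vec_index v r) * (mat_adjoint (M a) * M a) $$ (r, c) * vec_index v c)"
    by (subst sum.swap) (intro sum.cong refl sum.swap)
  also have "\<dots> = (\<Sum>r<D. \<Sum>c<D. cnj (vec_index v r) * 1\<^sub>m D $$ (r, c) * vec_index v c)"
    by (intro sum.cong refl)
      (simp add: one[symmetric] sum_distrib_left sum_distrib_right del: index_mult_mat index_one_mat)
  also have "\<dots> = (\<Sum>r<D. \<Sum>c<D. if r = c then cnj (vec_index v r) * vec_index v c else 0)"
    by (intro sum.cong refl) auto
  also have "\<dots> = complex_of_real (norm_sq v)"
    using v by (simp add: norm_sq_def complex_norm_square mult.commute del: of_real_power)
  finally show ?thesis by (simp only: of_real_eq_iff)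
qed

lemma norm_sq_measurement:
  assumes "measurement D S M" "v \<in> carrier_vec D"
  shows "(\<Sum>a\<in>S. norm_sq (M a *\<^sub>v v)) = norm_sq v"
  using assms by (intro sum_norm_sq_of_adjoint_sum) (auto simp: measurement_def)

text \<open>A unitary is treated as a measurement with a single outcome.\<close>

lemma norm_sq_unitary:
  assumes "unitary D U" "v \<in> carrier_vec D"
  shows "norm_sq (U *\<^sub>v v) = norm_sq v"
  using sum_norm_sq_of_adjoint_sum[of "{()}" "\<lambda>_. U" D v] assms by (simp add: unitary_def)

section \<open>Distances between states and the hybrid bound\<close>

definition vnorm :: "complex Matrix.vec \<Rightarrow> real" where
  "vnorm v = sqrt (norm_sq v)"

lemma norm_sq_nonneg: "0 \<le> norm_sq v"
  unfolding norm_sq_def by (intro sum_nonneg) auto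

lemma vnorm_eq_L2_set: "vnorm v = L2_set (\<lambda>k. cmod (vec_index v k)) {..<dim_vec v}"
  by (simp add: vnorm_def norm_sq_def L2_set_def)

lemma vnorm_triangle:
  assumes "x \<in> carrier_vec D" "y \<in> carrier_vec D"
  shows "vnorm (x + y) \<le> vnorm x + vnorm y"
proof -
  have "vnorm (x + y) = L2_set (\<lambda>k. cmod (vec_index x k + vec_index y k)) {..<D}"
    using assms by (simp add: vnorm_eq_L2_set L2_set_def)
  also have "\<dots> \<le> L2_set (\<lambda>k. cmod (vec_index x k) + cmod (vec_index y k)) {..<D}"
    by (intro L2_set_mono norm_triangle_ineq norm_ge_zero)
  also have "\<dots> \<le> vnorm x + vnorm y"
    using assms L2_set_triangle_ineq by (simp add: vnorm_eq_L2_set)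
  finally show ?thesis .
qed

lemma unitary_carrier: "unitary D U \<Longrightarrow> U \<in> carrier_mat D D"
  by (simp add: unitary_def)

lemma qstate_carrier:
  assumes "\<And>i. i \<le> k \<Longrightarrow> unitary (qdim n m) (U i)"
  shows "qstate n m U f k \<in> carrier_vec (qdim n m)"
  using assms
proof (induction k)
  case 0
  thus ?case using unitary_carrier[OF 0] by simp
next
  case (Suc k)
  thus ?case by (auto intro!: mult_mat_vec_carrier[OF unitary_carrier]
        mult_mat_vec_carrier[OF query_mat_carrier])
qed

lemma norm_sq_qstate:
  assumes "\<And>i. i \<le> k \<Longrightarrow> unitary (qdim n m) (U i)" "1 \<le> n" "1 \<le> m"
  shows "norm_sq (qstate n m U f k) = 1"
  using assms(1)
proof (induction k)
  case 0
  \<comment> \<open>An index outside the dimension would make \<open>unit_vec\<close> the zero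
    vector.\<close>
  have "qindex n m 0 0 0 0 < qdim n m" using assms by (intro qindex_less) auto
  hence "norm_sq (unit_vec (qdim n m) (qindex n m 0 0 0 0)) = 1"
    by (simp add: norm_sq_def if_distrib[of cmod] if_distrib[of "\<lambda>x. x ^ 2"] cong: if_cong)
  thus ?case using norm_sq_unitary[OF 0] by simp
next
  case (Suc k)
  have c: "qstate n m U f k \<in> carrier_vec (qdim n m)" using Suc by (intro qstate_carrier) auto
  show ?case
    using Suc norm_sq_unitary[of "qdim n m" "U (Suc k)"] norm_sq_query[OF c] c
    by (auto simp: mult_mat_vec_carrier[OF query_mat_carrier])
qed

text \<open>Each query adds an error governed by the weight on \<open>p\<close>, and later steps
  carry it along isometrically. All weights belong to the run on \<open>g\<close>, which does not
  depend on \<open>p\<close>, so the bounds for different \<open>p\<close> can later be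
  summed.\<close>

lemma vnorm_qstate_diff_le:
  assumes U: "\<And>i. i \<le> k \<Longrightarrow> unitary (qdim n m) (U i)"
    and p: "p \<in> {..<n} \<times> {..<n}"
    and agree: "\<And>p'. p' \<noteq> p \<Longrightarrow> f p' = g p'"
  shows "vnorm (qstate n m U g k - qstate n m U f k)
       \<le> (\<Sum>i<k. 2 * sqrt (cell_weight n m (qstate n m U g i) p))"
  using U
proof (induction k)
  case 0
  have "qstate n m U g 0 - qstate n m U f 0 = 0\<^sub>v (qdim n m)"
    using unitary_carrier[OF 0] by (intro eq_vecI) auto
  thus ?case by (simp add: vnorm_def norm_sq_def)
next
  case (Suc k)
  let ?D = "qdim n m" and ?G = "query_mat n m g" and ?F = "query_mat n m f"
  let ?x = "qstate n m U g k" and ?y = "qstate n m U f k"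
  have c: "?x \<in> carrier_vec ?D" "?y \<in> carrier_vec ?D"
    using Suc.prems by (auto intro!: qstate_carrier)
  have cU: "U (Suc k) \<in> carrier_mat ?D ?D" using Suc.prems by (auto intro: unitary_carrier)
  have cQ: "query_mat n m h *\<^sub>v v \<in> carrier_vec ?D" if "v \<in> carrier_vec ?D" for h v
    using mult_mat_vec_carrier[OF query_mat_carrier that] .
  have "qstate n m U g (Suc k) - qstate n m U f (Suc k) = U (Suc k) *\<^sub>v (?G *\<^sub>v ?x - ?F *\<^sub>v ?y)"
    by (simp add: mult_minus_distrib_mat_vec[OF cU cQ[OF c(1)] cQ[OF c(2)]])
  hence "vnorm (qstate n m U g (Suc k) - qstate n m U f (Suc k)) = vnorm (?G *\<^sub>v ?x - ?F *\<^sub>v ?y)"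
    unfolding vnorm_def using c cQ
    by (simp only: norm_sq_unitary[OF Suc.prems[OF order_refl] minus_carrier_vec])
  \<comment> \<open>The split makes the two operators differ on \<open>?x\<close>, the state of the
    run on \<open>g\<close>; the old error \<open>?x - ?y\<close> only passes through the isometry
    \<open>?F\<close>.\<close>
  also have "?G *\<^sub>v ?x - ?F *\<^sub>v ?y = (?G *\<^sub>v ?x - ?F *\<^sub>v ?x) + ?F *\<^sub>v (?x - ?y)"
    unfolding mult_minus_distrib_mat_vec[OF query_mat_carrier c]
    using cQ[OF c(1), of g] cQ[OF c(1), of f] cQ[OF c(2), of f]
    by (intro eq_vecI) (auto simp del: index_mult_mat_vec)
  also have "vnorm \<dots> \<le> vnorm (?G *\<^sub>v ?x - ?F *\<^sub>v ?x) + vnorm (?F *\<^sub>v (?x - ?y))"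
    using c cQ by (intro vnorm_triangle[of _ ?D]) auto
  also have "vnorm (?F *\<^sub>v (?x - ?y)) = vnorm (?x - ?y)"
    using c by (simp add: vnorm_def norm_sq_query)
  also have "\<dots> \<le> (\<Sum>i<k. 2 * sqrt (cell_weight n m (qstate n m U g i) p))"
    using Suc by auto
  also have "vnorm (?G *\<^sub>v ?x - ?F *\<^sub>v ?x) \<le> sqrt (4 * cell_weight n m ?x p)"
    unfolding vnorm_def using norm_sq_query_diff_le[OF c(1) p agree] by simp
  also have "\<dots> = 2 * sqrt (cell_weight n m ?x p)"
    by (simp add: real_sqrt_mult)
  finally show ?case by simp
qed

text \<open>The root of the probability of the event \<open>A\<close> is the L2 norm of the family
  \<open>vnorm (M a *\<^sub>v x)\<close> over \<open>A\<close>, hence obeys a triangle inequality.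
  For the difference, enlarging \<open>A\<close> to \<open>S\<close> yields the full norm.\<close>

lemma sqrt_prob_measurement_diff_le:
  assumes M: "measurement D S M" and "A \<subseteq> S"
    and x: "x \<in> carrier_vec D" and y: "y \<in> carrier_vec D"
  shows "sqrt (\<Sum>a\<in>A. norm_sq (M a *\<^sub>v x)) \<le> sqrt (\<Sum>a\<in>A. norm_sq (M a *\<^sub>v y)) + vnorm (x - y)"
proof -
  have cM: "M a \<in> carrier_mat D D" if "a \<in> A" for a
    using that assms by (auto simp: measurement_def)
  have L2: "sqrt (\<Sum>a\<in>A. norm_sq (M a *\<^sub>v v)) = L2_set (\<lambda>a. vnorm (M a *\<^sub>v v)) A" for v
    by (simp add: L2_set_def vnorm_def norm_sq_nonneg)
  have "L2_set (\<lambda>a. vnorm (M a *\<^sub>v x)) A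
      \<le> L2_set (\<lambda>a. vnorm (M a *\<^sub>v y) + vnorm (M a *\<^sub>v (x - y))) A"
  proof (rule L2_set_mono)
    fix a assume a: "a \<in> A"
    have "x = y + (x - y)" using x y by (intro eq_vecI) auto
    hence "M a *\<^sub>v x = M a *\<^sub>v y + M a *\<^sub>v (x - y)"
      using mult_add_distrib_mat_vec[OF cM[OF a] y, of "x - y"] x y by simp
    also have "vnorm \<dots> \<le> vnorm (M a *\<^sub>v y) + vnorm (M a *\<^sub>v (x - y))"
      by (intro vnorm_triangle[of _ D] mult_mat_vec_carrier[OF cM[OF a]] minus_carrier_vec x y)
    finally show "vnorm (M a *\<^sub>v x) \<le> vnorm (M a *\<^sub>v y) + vnorm (M a *\<^sub>v (x - y))" .
  qed (simp add: vnorm_def norm_sq_nonneg)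
  also have "\<dots> \<le> L2_set (\<lambda>a. vnorm (M a *\<^sub>v y)) A + L2_set (\<lambda>a. vnorm (M a *\<^sub>v (x - y))) A"
    by (rule L2_set_triangle_ineq)
  also have "L2_set (\<lambda>a. vnorm (M a *\<^sub>v (x - y))) A \<le> vnorm (x - y)"
  proof -
    have "(\<Sum>a\<in>A. norm_sq (M a *\<^sub>v (x - y))) \<le> (\<Sum>a\<in>S. norm_sq (M a *\<^sub>v (x - y)))"
      using M \<open>A \<subseteq> S\<close> by (intro sum_mono2) (auto simp: norm_sq_nonneg measurement_def)
    also have "\<dots> = norm_sq (x - y)" using x y by (intro norm_sq_measurement[OF M]) simp
    finally show ?thesis unfolding L2[symmetric] by (simp add: vnorm_def)
  qed
  finally show ?thesis unfolding L2 by simp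
qed

text \<open>As in \<open>rand_queries_ge\<close>, no answer is right for both \<open>g\<close> and
  \<open>h p\<close>. Success on both therefore forces the final states apart, which gives every
  cell a minimum of accumulated weight; the total weight per query is 1.\<close>

lemma quantum_queries_ge:
  fixes P :: "(nat \<times> nat \<Rightarrow> nat) \<Rightarrow> 'a \<Rightarrow> bool"
  assumes X_def: "X = {..<n} \<times> {..<n}"
    and nm: "1 \<le> n" "1 \<le> m"
    and U: "\<And>k. k \<le> q \<Longrightarrow> unitary (qdim n m) (U k)"
    and M: "measurement (qdim n m) S M"
    and correct: "2 / 3 \<le> (\<Sum>a | a \<in> S \<and> P g a. norm_sq (M a *\<^sub>v qstate n m U g q))"
    and correct': "\<And>p. p \<in> X \<Longrightarrow>
      2 / 3 \<le> (\<Sum>a | a \<in> S \<and> P (h p) a. norm_sq (M a *\<^sub>v qstate n m U (h p) q))"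
    and agree: "\<And>p p'. p \<in> X \<Longrightarrow> p' \<noteq> p \<Longrightarrow> h p p' = g p'"
    and disjoint: "\<And>p a. p \<in> X \<Longrightarrow> P g a \<Longrightarrow> \<not> P (h p) a"
  shows "real n / 10 \<le> real q"
proof -
  let ?W = "\<lambda>k p. cell_weight n m (qstate n m U g k) p"
  have fin: "finite S" using M by (simp add: measurement_def)
  have *: "1 / 100 \<le> real q * (\<Sum>k<q. ?W k p)" if p: "p \<in> X" for p
  proof -
    let ?x = "qstate n m U g q" and ?y = "qstate n m U (h p) q"
    let ?A = "{a \<in> S. P g a}" and ?B = "{a \<in> S. P (h p) a}"
    have c: "?x \<in> carrier_vec (qdim n m)" "?y \<in> carrier_vec (qdim n m)"
      using U by (auto intro: qstate_carrier)
    have "(\<Sum>a\<in>?A. norm_sq (M a *\<^sub>v ?y)) + (\<Sum>a\<in>?B. norm_sq (M a *\<^sub>v ?y))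
        = (\<Sum>a\<in>?A \<union> ?B. norm_sq (M a *\<^sub>v ?y))"
      using fin disjoint[OF p] by (intro sum.union_disjoint[symmetric]) auto
    also have "\<dots> \<le> (\<Sum>a\<in>S. norm_sq (M a *\<^sub>v ?y))"
      using fin by (intro sum_mono2) (auto simp: norm_sq_nonneg)
    also have "\<dots> = 1"
      using norm_sq_measurement[OF M c(2)] norm_sq_qstate[OF U nm] by simp
    \<comment> \<open>On \<open>h p\<close> the answers right for \<open>g\<close> are all wrong, so
      they share the failure probability.\<close>
    finally have y: "(\<Sum>a\<in>?A. norm_sq (M a *\<^sub>v ?y)) \<le> 1 / 3"
      using correct'[OF p] by simp
    have "sqrt (2 / 3) \<le> sqrt (\<Sum>a\<in>?A. norm_sq (M a *\<^sub>v ?x))"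
      using correct by simp
    also have "\<dots> \<le> sqrt (\<Sum>a\<in>?A. norm_sq (M a *\<^sub>v ?y)) + vnorm (?x - ?y)"
      by (rule sqrt_prob_measurement_diff_le[OF M _ c]) auto
    also have "sqrt (\<Sum>a\<in>?A. norm_sq (M a *\<^sub>v ?y)) \<le> sqrt (1 / 3)"
      using y by simp
    also have "vnorm (?x - ?y) \<le> (\<Sum>k<q. 2 * sqrt (?W k p))"
      using p agree[OF p] unfolding X_def by (intro vnorm_qstate_diff_le U) auto
    finally have "sqrt (2 / 3) - sqrt (1 / 3) \<le> 2 * (\<Sum>k<q. sqrt (?W k p))"
      by (simp add: sum_distrib_left)
    \<comment> \<open>Rational bounds for the roots, from 16/25 <= 2/3 and 1/3 <= 9/25. The gap 1/5,
      halved by the factor 2 of the hybrid bound, gives 1/10.\<close>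
    moreover have "sqrt (2 / 3) \<ge> 4 / 5"
      by (rule real_le_rsqrt) (simp add: power2_eq_square)
    moreover have "sqrt (1 / 3) \<le> 3 / 5"
      by (rule real_le_lsqrt) (simp_all add: power2_eq_square)
    ultimately have "1 / 10 \<le> (\<Sum>k<q. sqrt (?W k p))" by simp
    hence "(1 / 10)\<^sup>2 \<le> (\<Sum>k<q. 1 * sqrt (?W k p))\<^sup>2"
      by (intro power_mono) auto
    \<comment> \<open>Cauchy-Schwarz against the constant 1 replaces roots by the weights
      themselves, whose sum over all cells is known.\<close>
    also have "\<dots> \<le> (\<Sum>k<q. 1\<^sup>2) * (\<Sum>k<q. (sqrt (?W k p))\<^sup>2)"
      by (rule Cauchy_Schwarz_ineq_sum)
    finally show ?thesis by (simp add: cell_weight_nonneg power2_eq_square)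
  qed
  have "(real n / 10)\<^sup>2 = (\<Sum>p\<in>X. 1 / 100)"
    by (simp add: X_def card_cartesian_product power2_eq_square)
  also have "\<dots> \<le> (\<Sum>p\<in>X. real q * (\<Sum>k<q. ?W k p))"
    by (intro sum_mono *)
  also have "\<dots> = real q * (\<Sum>k<q. \<Sum>p\<in>X. ?W k p)"
    by (subst sum.swap) (simp add: sum_distrib_left)
  \<comment> \<open>\<open>X\<close> is the whole grid, so the weights at each time add up to the
    squared norm of a unit vector.\<close>
  also have "(\<Sum>k<q. \<Sum>p\<in>X. ?W k p) = (\<Sum>k<q. norm_sq (qstate n m U g k))"
    unfolding X_def using U
    by (intro sum.cong refl norm_sq_eq_sum_cell_weight[symmetric] qstate_carrier) auto
  also have "\<dots> = (\<Sum>k<q. 1)"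
    using U nm by (intro sum.cong refl norm_sq_qstate) auto
  finally have "(real n / 10)\<^sup>2 \<le> (real q)\<^sup>2" by (simp add: power2_eq_square)
  thus ?thesis by (rule power2_le_imp_le) simp
qed

section \<open>The table of ones and its neighbours\<close>

text \<open>The restricted abstraction makes the table extensional, as membership in
  \<open>inputs\<close> demands.\<close>

definition ones :: "nat \<Rightarrow> nat \<times> nat \<Rightarrow> nat" where
  "ones n = (\<lambda>p\<in>{0..<n} \<times> {0..<n}. 1)"

lemma ones_in_inputs: "ones n \<in> inputs n"
  by (auto simp: ones_def inputs_def)

lemma ones_upd_in_inputs: "p \<in> {..<n} \<times> {..<n} \<Longrightarrow> (ones n)(p := 0) \<in> inputs n"
  by (auto simp: ones_def inputs_def PiE_def extensional_def)

text \<open>Only \<open>None\<close> is right for the table of ones, and the cell \<open>p\<close>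
  as a square of size 1 refutes \<open>None\<close> on the changed table.\<close>

lemma LSQR_ones_disjoint:
  assumes "p \<in> {..<n} \<times> {..<n}" "LSQR n (ones n) a"
  shows "\<not> LSQR n ((ones n)(p := 0)) a"
proof -
  have "\<not> empty_square n (ones n) x y d" for x y d
  proof
    assume e: "empty_square n (ones n) x y d"
    \<comment> \<open>Since \<open>1 \<le> d\<close>, the corner belongs to the square.\<close>
    hence "ones n (x, y) = 0" by (force simp: empty_square_def)
    with e show False by (simp add: ones_def empty_square_def)
  qed
  hence "a = None" using assms(2) by (auto simp: LSQR_def split: option.splits)
  moreover have "empty_square n ((ones n)(p := 0)) (fst p) (snd p) 1"
    using assms(1) by (auto simp: empty_square_def)
  ultimately show ?thesis by (auto simp: LSQR_def)
qed

section \<open>From bounds on single algorithms to asymptotic bounds\<close>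

lemma ereal_le_INF_enat:
  assumes "\<And>q. q \<in> Q \<Longrightarrow> x \<le> real q"
  shows "ereal x \<le> ereal_of_enat (INF q\<in>Q. enat q)"
proof -
  \<comment> \<open>The infimum lives in \<open>enat\<close>, so the real bound is first rounded up
    to a natural number; an empty \<open>Q\<close> has infimum \<infinity>.\<close>
  have "enat (nat \<lceil>x\<rceil>) \<le> (INF q\<in>Q. enat q)"
  proof (rule INF_greatest)
    fix q assume "q \<in> Q"
    thus "enat (nat \<lceil>x\<rceil>) \<le> enat q"
      using assms[of q] by (simp add: nat_le_iff ceiling_le_iff)
  qed
  hence "ereal_of_enat (enat (nat \<lceil>x\<rceil>)) \<le> ereal_of_enat (INF q\<in>Q. enat q)"
    by (simp only: ereal_of_enat_le_iff)
  moreover have "ereal x \<le> ereal_of_enat (enat (nat \<lceil>x\<rceil>))"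
    by (simp add: real_nat_ceiling_ge)
  ultimately show ?thesis by (rule order_trans[rotated])
qed

lemma rand_query_complexity_LSQR_ge:
  "ereal (1 / 3 * (real n)\<^sup>2) \<le> ereal_of_enat (rand_query_complexity n (LSQR n))"
  unfolding rand_query_complexity_def
proof (rule ereal_le_INF_enat)
  fix q
  assume "q \<in> {q. \<exists>A :: answer dtree pmf.
    (\<forall>t\<in>set_pmf A. queries_within n t \<and> (\<forall>f\<in>inputs n. queries t f \<le> q)) \<and>
    (\<forall>f\<in>inputs n. 2 / 3 \<le> measure_pmf.prob A {t. LSQR n f (run t f)})}"
  then obtain A :: "answer dtree pmf" where
    q: "\<And>t f. t \<in> set_pmf A \<Longrightarrow> f \<in> inputs n \<Longrightarrow> queries t f \<le> q" and
    A: "\<And>f. f \<in> inputs n \<Longrightarrow> 2 / 3 \<le> measure_pmf.prob A {t. LSQR n f (run t f)}"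
    by blast
  have "card ({..<n} \<times> {..<n}) / 3 \<le> real q"
    by (rule rand_queries_ge[where P = "LSQR n" and h = "\<lambda>p. (ones n)(p := 0)",
          OF q[OF _ ones_in_inputs] A[OF ones_in_inputs] A[OF ones_upd_in_inputs] _
            LSQR_ones_disjoint]) auto
  thus "1 / 3 * (real n)\<^sup>2 \<le> real q"
    by (simp add: card_cartesian_product power2_eq_square)
qed

lemma quantum_query_complexity_LSQR_ge:
  assumes "1 \<le> n"
  shows "ereal (1 / 10 * real n) \<le> ereal_of_enat (quantum_query_complexity n (LSQR n))"
  unfolding quantum_query_complexity_def
proof (rule ereal_le_INF_enat)
  fix q
  assume "q \<in> {q. \<exists>m U (S :: answer set) M. 1 \<le> m \<and> (\<forall>k\<le>q. unitary (qdim n m) (U k)) \<and>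
    measurement (qdim n m) S M \<and>
    (\<forall>f\<in>inputs n. 2 / 3 \<le> (\<Sum>a | a \<in> S \<and> LSQR n f a. norm_sq (M a *\<^sub>v qstate n m U f q)))}"
  then obtain m U and S :: "answer set" and M where *: "1 \<le> m"
    "\<And>k. k \<le> q \<Longrightarrow> unitary (qdim n m) (U k)" "measurement (qdim n m) S M"
    and **: "\<And>f. f \<in> inputs n \<Longrightarrow>
      2 / 3 \<le> (\<Sum>a | a \<in> S \<and> LSQR n f a. norm_sq (M a *\<^sub>v qstate n m U f q))"
    by blast
  have "real n / 10 \<le> real q"
    by (rule quantum_queries_ge[where P = "LSQR n" and h = "\<lambda>p. (ones n)(p := 0)",
          OF refl assms * **[OF ones_in_inputs] **[OF ones_upd_in_inputs] _ LSQR_ones_disjoint])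
      auto
  thus "1 / 10 * real n \<le> real q" by simp
qed

text \<open>An evaluation costs at least one query, so the factor \<open>T n\<close> can only raise
  the count, and a bound on \<open>F\<close> from \<open>n = 1\<close> on transfers with the same
  constant.\<close>

lemma enat_bigomegaI:
  assumes T: "\<And>n. T n \<ge> 1" and "0 < c"
    and F: "\<And>n. 1 \<le> n \<Longrightarrow> ereal (c * \<bar>g n\<bar>) \<le> ereal_of_enat (F n)"
  shows "enat_bigomega (\<lambda>n. enat (T n) * F n) g"
  unfolding enat_bigomega_def
proof (intro exI[of _ c] conjI \<open>0 < c\<close> eventually_sequentiallyI[of 1])
  fix n :: nat assume "1 \<le> n"
  hence "ereal (c * \<bar>g n\<bar>) \<le> ereal_of_enat (F n)" by (rule F)
  also have "F n \<le> enat (T n) * F n"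
  proof -
    have "1 * F n \<le> enat (T n) * F n"
      using T[of n] by (intro mult_right_mono) (auto simp: one_enat_def)
    thus ?thesis by simp
  qed
  hence "ereal_of_enat (F n) \<le> ereal_of_enat (enat (T n) * F n)"
    by (simp only: ereal_of_enat_le_iff)
  finally show "ereal (c * \<bar>g n\<bar>) \<le> ereal_of_enat (enat (T n) * F n)" .
qed

theorem theorem5:
  fixes T :: "nat \<Rightarrow> nat"
  assumes "\<And>n. T n \<ge> 1"
    and "(\<lambda>n. real (T n)) \<in> O(\<lambda>_. 1)"
  shows "enat_bigomega (\<lambda>n. enat (T n) * det_query_complexity n (LSQR n)) (\<lambda>n. real n ^ 2) \<and>
         enat_bigomega (\<lambda>n. enat (T n) * rand_query_complexity n (LSQR n)) (\<lambda>n. real n ^ 2) \<and>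
         enat_bigomega (\<lambda>n. enat (T n) * quantum_query_complexity n (LSQR n)) (\<lambda>n. real n)"
proof (intro conjI)
  have rand: "ereal (1 / 3 * \<bar>(real n)\<^sup>2\<bar>) \<le> ereal_of_enat (rand_query_complexity n (LSQR n))" for n
    using rand_query_complexity_LSQR_ge[of n] by simp
  show "enat_bigomega (\<lambda>n. enat (T n) * rand_query_complexity n (LSQR n)) (\<lambda>n. real n ^ 2)"
    by (rule enat_bigomegaI[OF assms(1) _ rand]) simp
  \<comment> \<open>The deterministic case inherits the constant 1/3 from the randomized
    one.\<close>
  have "ereal_of_enat (rand_query_complexity n (LSQR n))
      \<le> ereal_of_enat (det_query_complexity n (LSQR n))" for n
    by (simp add: rand_le_det_query_complexity)
  note det = order_trans[OF rand this]
  show "enat_bigomega (\<lambda>n. enat (T n) * det_query_complexity n (LSQR n)) (\<lambda>n. real n ^ 2)"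
    by (rule enat_bigomegaI[OF assms(1) _ det]) simp
  have quantum: "ereal (1 / 10 * \<bar>real n\<bar>) \<le> ereal_of_enat (quantum_query_complexity n (LSQR n))"
    if "1 \<le> n" for n
    using quantum_query_complexity_LSQR_ge[OF that] by simp
  show "enat_bigomega (\<lambda>n. enat (T n) * quantum_query_complexity n (LSQR n)) (\<lambda>n. real n)"
    by (rule enat_bigomegaI[OF assms(1) _ quantum]) simp_all
qed

end
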